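(* There exists a fermionic matrix product unitary with periodic boundary conditions which is not locality-preserving. Explicitly, take two fermionic modes per site ($d=4$), $D=3$, $Z=\mathrm{diag}(+1,+1,-1)$, and let the tensor $\mathcal U$ have as its only nonzero elements $$U^{0,0}_{\alpha,\beta}=\delta_{\alpha,\beta}\quad(\alpha,\beta=0,1,2),\qquad U^{n,m}_{\alpha,\beta}=\delta_{\alpha,n-1}\,\delta_{\beta,m-1}\quad(\alpha,\beta=0,1,2;\ n,m=1,2,3).$$ Then these matrices satisfy $ZU^{n,m}=(-1)^{|n|+|m|}U^{n,m}Z$ for all $n,m$; the operator $$U^{(N)}=\sum_{n_1,\dots,n_N,\,m_1,\dots,m_N}\mathrm{tr}\left(Z\,U^{n_1,m_1}\cdots U^{n_N,m_N}\right)f_1^{n_1,m_1}\cdots f_N^{n_N,m_N}$$ is unitary for every $N\ge 1$; and the family $(U^{(N)})_{N\geq 1}$ is not locality-preserving: there is no finite $r$ such that, for every $N$, every site $j$ and every operator $\mathcal O_j$ acting only on site $j$, the operator $U^{(N)\dagger}\mathcal O_jU^{(N)}$ is supported on the sites at distance at most $r$ from $j$.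
   Context: Chain (ring) of $N$ sites; site $x$ carries two fermionic modes with annihilation operators $a_{x,1},a_{x,2}$ satisfying canonical anticommutation relations, and $|\Omega\rangle$ is the vacuum. For $n\in\{0,1,2,3\}$ with binary decomposition $(n^{(1)},n^{(2)})$ put $(a_x^\dagger)^n=(a_{x,1}^\dagger)^{n^{(1)}}(a_{x,2}^\dagger)^{n^{(2)}}$, and $|n|=n^{(1)}+n^{(2)}\bmod 2$ (so $|0|=|3|=0$, $|1|=|2|=1$). The vectors $|p_1,\dots,p_N\rangle=(a_1^\dagger)^{p_1}\cdots(a_N^\dagger)^{p_N}|\Omega\rangle$ form an orthonormal basis of the Fock space. The operator $f_x^{n,m}$ is defined by $$f_x^{n,m}|p_1,\dots,p_N\rangle=\delta_{m,p_x}(-1)^{(|n|+|m|)\sum_{y<x}|p_y|}\,|p_1,\dots,p_{x-1},n,p_{x+1},\dots,p_N\rangle .$$ An operator "acts only on site $j$" (resp. "is supported on a set $R$ of sites") if it belongs to the algebra generated by $a_{j,1},a_{j,2}$ and their adjoints (resp. by the modes of the sites of $R$ and their adjoints). A fermionic matrix product unitary (fMPU) with periodic boundary conditions is an operator family $U^{(N)}$ of the displayed form, where $Z$ is a diagonal $\pm1$ matrix on the auxiliary space and the $D\times D$ matrices $U^{n,m}$ satisfy $ZU^{n,m}=(-1)^{|n|+|m|}U^{n,m}Z$, such that $U^{(N)}$ is unitary for all $N\geq1$. *)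

theory Defs
  imports Complex_Main "Jordan_Normal_Form.Schur_Decomposition"
begin

section \<open>Fock space\<close>

text \<open>
  The Fock space of \<open>M\<close> fermionic modes \<open>0, \<dots>, M - 1\<close> is realised on \<open>carrier_vec (2 ^ M)\<close>: the
  \<open>i\<close>-th unit vector is the state in which mode \<open>k\<close> is occupied iff bit \<open>k\<close> of \<open>i\<close> is set, and the
  sign in \<open>annihilation\<close> is the Jordan--Wigner sign, so that the canonical anticommutation relations
  hold (\<open>CAR_annihilation\<close>, \<open>CAR_creation\<close>).
\<close>

definition annihilation :: "nat \<Rightarrow> nat \<Rightarrow> complex mat" where
  "annihilation M k = mat (2 ^ M) (2 ^ M) (\<lambda>(i, j).
     if bit j k \<and> i = unset_bit k j then (-1) ^ card {l. l < k \<and> bit j l} else 0)"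

definition vacuum :: "nat \<Rightarrow> complex vec" where
  "vacuum M = unit_vec (2 ^ M) 0"

text \<open>
  Sites are numbered \<open>0, \<dots>, N - 1\<close>; site \<open>x\<close> carries the modes \<open>2 * x\<close> and \<open>2 * x + 1\<close>, which are
  the ones called $a_{x,1}$ and $a_{x,2}$.
\<close>

definition site_annihilation :: "nat \<Rightarrow> nat \<Rightarrow> nat \<Rightarrow> complex mat" where
  "site_annihilation N x i = annihilation (2 * N) (2 * x + (i - 1))"

text \<open>
  Binary decomposition $n = 2 n^{(1)} + n^{(2)}$ of \<open>n < 4\<close>, most significant digit first.
\<close>

definition bin_digit1 :: "nat \<Rightarrow> nat" where "bin_digit1 n = n div 2"
definition bin_digit2 :: "nat \<Rightarrow> nat" where "bin_digit2 n = n mod 2"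

definition parity :: "nat \<Rightarrow> nat" where
  "parity n = (bin_digit1 n + bin_digit2 n) mod 2"

definition site_creation :: "nat \<Rightarrow> nat \<Rightarrow> nat \<Rightarrow> complex mat" where
  "site_creation N x n =
     mat_adjoint (site_annihilation N x 1) ^\<^sub>m bin_digit1 n *
     mat_adjoint (site_annihilation N x 2) ^\<^sub>m bin_digit2 n"

definition configs :: "nat \<Rightarrow> nat list set" where
  "configs N = {p. length p = N \<and> set p \<subseteq> {..<4}}"

definition ket :: "nat \<Rightarrow> nat list \<Rightarrow> complex vec" where
  "ket N p = foldr (\<lambda>x v. site_creation N x (p ! x) *\<^sub>v v) [0..<N] (vacuum (2 * N))"

text \<open>
  The matrix of $f_x^{n,m} = \sum_p \delta_{m,p_x} (-1)^{(|n|+|m|)\sum_{y<x}|p_y|}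
  |p_1,\dots,n,\dots,p_N\rangle\langle p_1,\dots,p_N|$. Lemma \<open>f_op_ket\<close> gives its
  action on the basis.
\<close>

definition f_op :: "nat \<Rightarrow> nat \<Rightarrow> nat \<Rightarrow> nat \<Rightarrow> complex mat" where
  "f_op N x n m = mat (2 ^ (2 * N)) (2 ^ (2 * N)) (\<lambda>(i, j).
     \<Sum>p\<in>configs N. (if p ! x = m then 1 else 0)
        * (-1) ^ ((parity n + parity m) * (\<Sum>y<x. parity (p ! y)))
        * ket N (p[x := n]) $ i * cnj (ket N p $ j))"

section \<open>Local algebras\<close>

inductive_set generated_algebra :: "nat \<Rightarrow> complex mat set \<Rightarrow> complex mat set"
  for n :: nat and S :: "complex mat set" where
  gen: "A \<in> S \<Longrightarrow> A \<in> generated_algebra n S"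
| one: "1\<^sub>m n \<in> generated_algebra n S"
| smult: "A \<in> generated_algebra n S \<Longrightarrow> c \<cdot>\<^sub>m A \<in> generated_algebra n S"
| add: "A \<in> generated_algebra n S \<Longrightarrow> B \<in> generated_algebra n S \<Longrightarrow> A + B \<in> generated_algebra n S"
| mult: "A \<in> generated_algebra n S \<Longrightarrow> B \<in> generated_algebra n S \<Longrightarrow> A * B \<in> generated_algebra n S"

definition local_algebra :: "nat \<Rightarrow> nat set \<Rightarrow> complex mat set" where
  "local_algebra N R = generated_algebra (2 ^ (2 * N))
     (\<Union>x\<in>R. \<Union>i\<in>{1, 2}. {site_annihilation N x i, mat_adjoint (site_annihilation N x i)})"

definition ring_dist :: "nat \<Rightarrow> nat \<Rightarrow> nat \<Rightarrow> nat" where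
  "ring_dist N x y = (let k = max x y - min x y in min k (N - k))"

definition locality_preserving :: "(nat \<Rightarrow> complex mat) \<Rightarrow> bool" where
  "locality_preserving V \<longleftrightarrow>
     (\<exists>r. \<forall>N\<ge>1. \<forall>j<N. \<forall>A\<in>local_algebra N {j}.
        mat_adjoint (V N) * A * V N \<in> local_algebra N {x. x < N \<and> ring_dist N j x \<le> r})"

section \<open>Fermionic matrix product unitaries\<close>

definition unitary_mat :: "nat \<Rightarrow> complex mat \<Rightarrow> bool" where
  "unitary_mat n A \<longleftrightarrow> A \<in> carrier_mat n n \<and> mat_adjoint A * A = 1\<^sub>m n \<and> A * mat_adjoint A = 1\<^sub>m n"

definition mat_prod_list :: "nat \<Rightarrow> complex mat list \<Rightarrow> complex mat" where
  "mat_prod_list n As = foldr (*) As (1\<^sub>m n)"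

definition mat_trace :: "complex mat \<Rightarrow> complex" where
  "mat_trace A = sum_list (diag_mat A)"

definition fMPO :: "nat \<Rightarrow> complex mat \<Rightarrow> (nat \<Rightarrow> nat \<Rightarrow> complex mat) \<Rightarrow> nat \<Rightarrow> complex mat" where
  "fMPO D Z U N = mat (2 ^ (2 * N)) (2 ^ (2 * N)) (\<lambda>ij.
     \<Sum>ns\<in>configs N. \<Sum>ms\<in>configs N.
       mat_trace (Z * mat_prod_list D (map (\<lambda>x. U (ns ! x) (ms ! x)) [0..<N]))
       * mat_prod_list (2 ^ (2 * N)) (map (\<lambda>x. f_op N x (ns ! x) (ms ! x)) [0..<N]) $$ ij)"

definition graded_tensor :: "nat \<Rightarrow> complex mat \<Rightarrow> (nat \<Rightarrow> nat \<Rightarrow> complex mat) \<Rightarrow> bool" where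
  "graded_tensor D Z U \<longleftrightarrow>
     Z \<in> carrier_mat D D \<and> diagonal_mat Z \<and> (\<forall>i<D. Z $$ (i, i) = 1 \<or> Z $$ (i, i) = -1) \<and>
     (\<forall>n<4. \<forall>m<4. U n m \<in> carrier_mat D D \<and>
        Z * U n m = (-1) ^ (parity n + parity m) \<cdot>\<^sub>m (U n m * Z))"

definition is_fMPU :: "nat \<Rightarrow> complex mat \<Rightarrow> (nat \<Rightarrow> nat \<Rightarrow> complex mat) \<Rightarrow> bool" where
  "is_fMPU D Z U \<longleftrightarrow>
     graded_tensor D Z U \<and> (\<forall>N\<ge>1. unitary_mat (2 ^ (2 * N)) (fMPO D Z U N))"

definition Z_ex :: "complex mat" where
  "Z_ex = mat_of_rows_list 3 [[1, 0, 0], [0, 1, 0], [0, 0, -1]]"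

definition U_ex :: "nat \<Rightarrow> nat \<Rightarrow> complex mat" where
  "U_ex n m = mat 3 3 (\<lambda>(\<alpha>, \<beta>).
     if n = 0 \<and> m = 0 then (if \<alpha> = \<beta> then 1 else 0)
     else if n \<in> {1..3} \<and> m \<in> {1..3} then (if \<alpha> = n - 1 \<and> \<beta> = m - 1 then 1 else 0)
     else 0)"

section \<open>Canonical anticommutation relations, and the action of \<open>f_op\<close> on the basis\<close>

definition jw_sign :: "nat \<Rightarrow> nat \<Rightarrow> complex" where
  "jw_sign k j = (-1) ^ card {l. l < k \<and> bit j l}"

lemma unset_bit_less:
  fixes j :: nat
  assumes "j < 2 ^ M" shows "unset_bit k j < 2 ^ M"
proof -
  have "n < M" if "bit j n" for n
    using assms that by (metis bit_take_bit_iff take_bit_nat_eq_self)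
  hence "take_bit M (unset_bit k j) = unset_bit k j"
    by (intro bit_eqI) (auto simp: bit_simps)
  thus ?thesis by (simp only: take_bit_nat_eq_self_iff)
qed

lemma set_bit_less:
  fixes j :: nat
  assumes "j < 2 ^ M" "k < M" shows "set_bit k j < 2 ^ M"
proof -
  have "take_bit M (set_bit k j) = set_bit k j"
    using assms by (simp add: take_bit_set_bit_eq take_bit_nat_eq_self)
  thus ?thesis by (simp only: take_bit_nat_eq_self_iff)
qed

lemma annihilation_carrier [simp]: "annihilation M k \<in> carrier_mat (2 ^ M) (2 ^ M)"
  by (simp add: annihilation_def)

lemma dim_mat_adjoint [simp]: "dim_row (mat_adjoint A) = dim_col A" "dim_col (mat_adjoint A) = dim_row A"
  by (simp_all add: mat_adjoint_def)

lemma mat_adjoint_index: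
  "i < dim_col A \<Longrightarrow> j < dim_row A \<Longrightarrow> mat_adjoint A $$ (i, j) = conjugate (A $$ (j, i))"
  by (simp add: mat_adjoint_def mat_of_rows_index)

lemma mat_adjoint_carrier: "A \<in> carrier_mat n m \<Longrightarrow> mat_adjoint A \<in> carrier_mat m n"
  by (intro carrier_matI) auto

lemma annihilation_unit_vec:
  assumes "j < 2 ^ M"
  shows "annihilation M k *\<^sub>v unit_vec (2 ^ M) j =
    (if bit j k then jw_sign k j \<cdot>\<^sub>v unit_vec (2 ^ M) (unset_bit k j) else 0\<^sub>v (2 ^ M))"
  using assms unset_bit_less[OF assms, of k]
  by (intro eq_vecI) (auto simp: annihilation_def jw_sign_def)

lemma set_unset_bit:
  fixes j :: nat shows "bit j k \<Longrightarrow> set_bit k (unset_bit k j) = j"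
  by (intro bit_eqI) (auto simp: bit_simps)

lemma unset_set_bit:
  fixes j :: nat shows "\<not> bit j k \<Longrightarrow> unset_bit k (set_bit k j) = j"
  by (intro bit_eqI) (auto simp: bit_simps)

lemma bit_flip_conv:
  fixes i j :: nat
  shows "bit j k \<and> i = unset_bit k j \<longleftrightarrow> \<not> bit i k \<and> j = set_bit k i"
  by (auto simp: set_unset_bit unset_set_bit bit_simps)

lemma jw_sign_set_bit_same: "jw_sign k (set_bit k j) = jw_sign k j"
proof -
  have "{l. l < k \<and> bit (set_bit k j) l} = {l. l < k \<and> bit j l}"
    by (auto simp: bit_simps)
  thus ?thesis by (simp add: jw_sign_def)
qed

lemma creation_unit_vec:
  assumes "j < 2 ^ M" "k < M"
  shows "mat_adjoint (annihilation M k) *\<^sub>v unit_vec (2 ^ M) j =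
    (if bit j k then 0\<^sub>v (2 ^ M) else jw_sign k j \<cdot>\<^sub>v unit_vec (2 ^ M) (set_bit k j))"
proof (intro eq_vecI)
  fix i assume "i < dim_vec (if bit j k then 0\<^sub>v (2 ^ M) else jw_sign k j \<cdot>\<^sub>v unit_vec (2 ^ M) (set_bit k j))"
  hence i: "i < 2 ^ M" by (auto split: if_splits)
  have "(mat_adjoint (annihilation M k) *\<^sub>v unit_vec (2 ^ M) j) $ i = cnj (annihilation M k $$ (j, i))"
    using assms i by (simp add: mat_adjoint_index carrier_matD[OF annihilation_carrier])
  also have "annihilation M k $$ (j, i) = (if \<not> bit j k \<and> i = set_bit k j then jw_sign k i else 0)"
    using assms i unfolding bit_flip_conv[symmetric] by (simp add: annihilation_def jw_sign_def)
  finally show "(mat_adjoint (annihilation M k) *\<^sub>v unit_vec (2 ^ M) j) $ i =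
     (if bit j k then 0\<^sub>v (2 ^ M) else jw_sign k j \<cdot>\<^sub>v unit_vec (2 ^ M) (set_bit k j)) $ i"
    using assms i set_bit_less[OF assms] by (auto simp: jw_sign_set_bit_same) (simp add: jw_sign_def)
qed (auto simp: carrier_matD[OF annihilation_carrier])

lemma mat_eq_by_unit_vecs:
  assumes "A \<in> carrier_mat n n" "B \<in> carrier_mat n n"
    and "\<And>j. j < n \<Longrightarrow> A *\<^sub>v unit_vec n j = B *\<^sub>v unit_vec n j"
  shows "A = (B :: complex mat)"
proof (rule eq_matI)
  fix i j assume ij: "i < dim_row B" "j < dim_col B"
  with assms have "(A *\<^sub>v unit_vec n j) $ i = (B *\<^sub>v unit_vec n j) $ i" by simp
  thus "A $$ (i, j) = B $$ (i, j)" using assms(1,2) ij by simp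
qed (use assms in auto)

lemma jw_sign_set_bit:
  assumes "\<not> bit j l"
  shows "jw_sign k (set_bit l j) = (if l < k then - jw_sign k j else jw_sign k j)"
proof (cases "l < k")
  case True
  hence "{i. i < k \<and> bit (set_bit l j) i} = insert l {i. i < k \<and> bit j i}"
    by (auto simp: bit_simps)
  thus ?thesis using True assms by (simp add: jw_sign_def)
next
  case False
  hence "{i. i < k \<and> bit (set_bit l j) i} = {i. i < k \<and> bit j i}"
    by (auto simp: bit_simps)
  thus ?thesis using False by (simp add: jw_sign_def)
qed

lemma jw_sign_unset_bit:
  assumes "bit j l"
  shows "jw_sign k (unset_bit l j) = (if l < k then - jw_sign k j else jw_sign k j)"
proof -
  have "set_bit l (unset_bit l j) = j" "\<not> bit (unset_bit l j) l"
    using assms by (auto simp: set_unset_bit bit_simps)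
  thus ?thesis using jw_sign_set_bit[of "unset_bit l j" l k] by (auto split: if_splits)
qed

lemma jw_sign_square: "jw_sign k j * jw_sign k j = 1"
  by (simp add: jw_sign_def power_mult_distrib[symmetric])

lemma anticommutator_mult_vec:
  assumes "A \<in> carrier_mat n n" "B \<in> carrier_mat n n" "v \<in> carrier_vec n"
  shows "(A * B + B * A) *\<^sub>v v = A *\<^sub>v (B *\<^sub>v v) + B *\<^sub>v (A *\<^sub>v (v :: complex vec))"
  using assms by (simp add: add_mult_distrib_mat_vec[of _ n n])

lemma CAR_annihilation:
  "annihilation M k * annihilation M l + annihilation M l * annihilation M k = 0\<^sub>m (2 ^ M) (2 ^ M)"
proof (rule mat_eq_by_unit_vecs[where n = "2 ^ M"])
  fix j :: nat assume j: "j < 2 ^ M"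
  have smult: "annihilation M i *\<^sub>v (c \<cdot>\<^sub>v unit_vec (2 ^ M) h) = c \<cdot>\<^sub>v (annihilation M i *\<^sub>v unit_vec (2 ^ M) h)" for i c h
    by (rule mult_mat_vec[OF annihilation_carrier]) simp
  have zero: "annihilation M i *\<^sub>v 0\<^sub>v (2 ^ M) = 0\<^sub>v (2 ^ M)" for i
    by (intro eq_vecI) (auto simp: carrier_matD[OF annihilation_carrier])
  have comm: "unset_bit l (unset_bit k j) = unset_bit k (unset_bit l j)"
    by (intro bit_eqI) (auto simp: bit_simps)
  have "annihilation M k *\<^sub>v (annihilation M l *\<^sub>v unit_vec (2 ^ M) j)
      + annihilation M l *\<^sub>v (annihilation M k *\<^sub>v unit_vec (2 ^ M) j) = 0\<^sub>v (2 ^ M)"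
    using j
    by (cases "bit j k"; cases "bit j l"; cases k l rule: linorder_cases;
        simp add: annihilation_unit_vec smult zero unset_bit_less bit_simps jw_sign_unset_bit comm;
        intro eq_vecI; simp)
  thus "(annihilation M k * annihilation M l + annihilation M l * annihilation M k) *\<^sub>v unit_vec (2 ^ M) j
      = 0\<^sub>m (2 ^ M) (2 ^ M) *\<^sub>v unit_vec (2 ^ M) j"
    by (subst anticommutator_mult_vec[of _ "2 ^ M"]) auto
qed (auto intro!: mult_carrier_mat[where n = "2 ^ M"] add_carrier_mat)

lemma CAR_creation:
  assumes "l < M"
  shows "annihilation M k * mat_adjoint (annihilation M l) + mat_adjoint (annihilation M l) * annihilation M k
    = (if k = l then 1\<^sub>m (2 ^ M) else 0\<^sub>m (2 ^ M) (2 ^ M))"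
proof (rule mat_eq_by_unit_vecs[where n = "2 ^ M"])
  fix j :: nat assume j: "j < 2 ^ M"
  let ?C = "mat_adjoint (annihilation M l)"
  note C = mat_adjoint_carrier[OF annihilation_carrier[of M l]]
  have smult: "annihilation M i *\<^sub>v (c \<cdot>\<^sub>v unit_vec (2 ^ M) h) = c \<cdot>\<^sub>v (annihilation M i *\<^sub>v unit_vec (2 ^ M) h)"
    "?C *\<^sub>v (c \<cdot>\<^sub>v unit_vec (2 ^ M) h) = c \<cdot>\<^sub>v (?C *\<^sub>v unit_vec (2 ^ M) h)" for i c h
    by (rule mult_mat_vec[OF annihilation_carrier], simp) (rule mult_mat_vec[OF C], simp)
  have zero: "annihilation M i *\<^sub>v 0\<^sub>v (2 ^ M) = 0\<^sub>v (2 ^ M)" "?C *\<^sub>v 0\<^sub>v (2 ^ M) = 0\<^sub>v (2 ^ M)" for i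
    using C by (auto intro!: eq_vecI simp: carrier_matD[OF annihilation_carrier])
  have comm: "unset_bit k (set_bit l j) = set_bit l (unset_bit k j)" if "k \<noteq> l"
    using that by (intro bit_eqI) (auto simp: bit_simps)
  have "annihilation M k *\<^sub>v (?C *\<^sub>v unit_vec (2 ^ M) j) + ?C *\<^sub>v (annihilation M k *\<^sub>v unit_vec (2 ^ M) j)
      = (if k = l then unit_vec (2 ^ M) j else 0\<^sub>v (2 ^ M))"
  proof (cases "k = l")
    case True
    thus ?thesis using j assms
      by (cases "bit j l")
        (auto simp: annihilation_unit_vec creation_unit_vec smult zero unset_bit_less set_bit_less bit_simps
          jw_sign_unset_bit jw_sign_set_bit jw_sign_square smult_smult_assoc set_unset_bit unset_set_bit)
  next
    case False
    thus ?thesis using j assms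
      by (cases "bit j k"; cases "bit j l"; cases "l < k"; cases "k < l";
          simp add: annihilation_unit_vec creation_unit_vec smult zero unset_bit_less set_bit_less bit_simps
            jw_sign_unset_bit jw_sign_set_bit comm;
          intro eq_vecI; simp)
  qed
  thus "(annihilation M k * ?C + ?C * annihilation M k) *\<^sub>v unit_vec (2 ^ M) j =
     (if k = l then 1\<^sub>m (2 ^ M) else 0\<^sub>m (2 ^ M) (2 ^ M)) *\<^sub>v unit_vec (2 ^ M) j"
    using C by (subst anticommutator_mult_vec[of _ "2 ^ M"]) auto
qed (auto intro!: mult_carrier_mat[where n = "2 ^ M"] add_carrier_mat mat_adjoint_carrier)

lemma site_annihilation_carrier [simp]: "site_annihilation N x i \<in> carrier_mat (2 ^ (2 * N)) (2 ^ (2 * N))"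
  by (simp add: site_annihilation_def)

lemma configs_nth: "p \<in> configs N \<Longrightarrow> x < N \<Longrightarrow> p ! x < 4"
  by (metis (mono_tags, lifting) configs_def lessThan_iff mem_Collect_eq nth_mem subsetD)

lemma creation_power_unit_vec:
  assumes "b < 2" "k < M" "j < 2 ^ M" "\<And>l. l \<le> k \<Longrightarrow> \<not> bit j l"
  shows "mat_adjoint (annihilation M k) ^\<^sub>m b *\<^sub>v unit_vec (2 ^ M) j =
    unit_vec (2 ^ M) (if b = 1 then set_bit k j else j)"
proof -
  have "{l. l < k \<and> bit j l} = {}" using assms(4) by auto
  hence "jw_sign k j = 1" unfolding jw_sign_def by (simp only: card.empty power_0)
  moreover have "b = 0 \<or> b = 1" using assms(1) by auto
  ultimately show ?thesis
    using assms mat_adjoint_carrier[OF annihilation_carrier[of M k]] by (auto simp: creation_unit_vec)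
qed

lemma site_creation_unit_vec:
  assumes "n < 4" "x < N" "j < 2 ^ (2 * N)" "\<And>l. l < 2 * x + 2 \<Longrightarrow> \<not> bit j l"
  shows "site_creation N x n *\<^sub>v unit_vec (2 ^ (2 * N)) j =
    unit_vec (2 ^ (2 * N)) (let j' = if bin_digit2 n = 1 then set_bit (2 * x + 1) j else j
                            in if bin_digit1 n = 1 then set_bit (2 * x) j' else j')"
proof -
  define j' where "j' = (if bin_digit2 n = 1 then set_bit (2 * x + 1) j else j)"
  have d: "bin_digit1 n < 2" "bin_digit2 n < 2" using assms(1) by (auto simp: bin_digit1_def bin_digit2_def)
  have j': "j' < 2 ^ (2 * N)" "\<And>l. l \<le> 2 * x \<Longrightarrow> \<not> bit j' l"
    using assms by (auto simp: j'_def bit_simps set_bit_less)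
  have "site_creation N x n *\<^sub>v unit_vec (2 ^ (2 * N)) j =
    mat_adjoint (annihilation (2 * N) (2 * x)) ^\<^sub>m bin_digit1 n *\<^sub>v
      (mat_adjoint (annihilation (2 * N) (2 * x + 1)) ^\<^sub>m bin_digit2 n *\<^sub>v unit_vec (2 ^ (2 * N)) j)"
    unfolding site_creation_def site_annihilation_def
    by (subst assoc_mult_mat_vec[of _ "2 ^ (2 * N)" "2 ^ (2 * N)" _ "2 ^ (2 * N)"])
      (auto intro!: pow_carrier_mat mat_adjoint_carrier)
  also have "mat_adjoint (annihilation (2 * N) (2 * x + 1)) ^\<^sub>m bin_digit2 n *\<^sub>v unit_vec (2 ^ (2 * N)) j
     = unit_vec (2 ^ (2 * N)) j'"
    unfolding j'_def using assms d by (intro creation_power_unit_vec) auto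
  also have "mat_adjoint (annihilation (2 * N) (2 * x)) ^\<^sub>m bin_digit1 n *\<^sub>v unit_vec (2 ^ (2 * N)) j'
     = unit_vec (2 ^ (2 * N)) (if bin_digit1 n = 1 then set_bit (2 * x) j' else j')"
    using assms d j' by (intro creation_power_unit_vec) auto
  finally show ?thesis by (simp add: j'_def Let_def)
qed

lemma ket_eq_unit_vec:
  assumes "p \<in> configs N"
  obtains i where "i < 2 ^ (2 * N)" "ket N p = unit_vec (2 ^ (2 * N)) i"
    "\<And>k. bit i k \<longleftrightarrow> k < 2 * N \<and> (if even k then bin_digit1 else bin_digit2) (p ! (k div 2)) = 1"
proof -
  have "\<exists>i<2 ^ (2 * N). foldr (\<lambda>x v. site_creation N x (p ! x) *\<^sub>v v) [s..<N] (vacuum (2 * N))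
      = unit_vec (2 ^ (2 * N)) i \<and>
      (\<forall>k. bit i k \<longleftrightarrow> 2 * s \<le> k \<and> k < 2 * N \<and> (if even k then bin_digit1 else bin_digit2) (p ! (k div 2)) = 1)"
    if "s \<le> N" for s using that
  proof (induction rule: inc_induct)
    case base
    show ?case by (intro exI[of _ 0]) (auto simp: vacuum_def)
  next
    case (step s)
    then obtain i where i: "i < 2 ^ (2 * N)"
      "foldr (\<lambda>x v. site_creation N x (p ! x) *\<^sub>v v) [Suc s..<N] (vacuum (2 * N)) = unit_vec (2 ^ (2 * N)) i"
      "\<And>k. bit i k \<longleftrightarrow> 2 * Suc s \<le> k \<and> k < 2 * N \<and> (if even k then bin_digit1 else bin_digit2) (p ! (k div 2)) = 1"
      by blast
    define i' where "i' = (let j' = if bin_digit2 (p ! s) = 1 then set_bit (2 * s + 1) i else i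
                            in if bin_digit1 (p ! s) = 1 then set_bit (2 * s) j' else j')"
    have "foldr (\<lambda>x v. site_creation N x (p ! x) *\<^sub>v v) [s..<N] (vacuum (2 * N)) = unit_vec (2 ^ (2 * N)) i'"
      using site_creation_unit_vec[OF configs_nth[OF assms step(2)] step(2) i(1)] step(2)
      by (simp only: upt_conv_Cons foldr.simps o_apply i(2) i'_def) (simp add: i(3))
    moreover have "i' < 2 ^ (2 * N)"
      using i(1) step(2) by (auto simp: i'_def Let_def intro!: set_bit_less)
    moreover have "bit i' k \<longleftrightarrow> 2 * s \<le> k \<and> k < 2 * N \<and> (if even k then bin_digit1 else bin_digit2) (p ! (k div 2)) = 1" for k
    proof -
      have "k < 2 * s \<or> k = 2 * s \<or> k = 2 * s + 1 \<or> 2 * Suc s \<le> k" by presburger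
      thus ?thesis
        using step(2) by (elim disjE) (auto simp: i'_def Let_def bit_simps i(3))
    qed
    ultimately show ?case by blast
  qed
  from this[of 0] show ?thesis using that by (auto simp: ket_def)
qed

lemma bin_digits_inject: "bin_digit1 n = bin_digit1 m \<Longrightarrow> bin_digit2 n = bin_digit2 m \<Longrightarrow> n = m"
  unfolding bin_digit1_def bin_digit2_def by (metis div_mult_mod_eq)

lemma ket_orthonormal:
  assumes p: "p \<in> configs N" and q: "q \<in> configs N"
  shows "ket N p \<bullet>c ket N q = (if p = q then 1 else 0)"
proof -
  obtain i where i: "i < 2 ^ (2 * N)" "ket N p = unit_vec (2 ^ (2 * N)) i"
    "\<And>k. bit i k \<longleftrightarrow> k < 2 * N \<and> (if even k then bin_digit1 else bin_digit2) (p ! (k div 2)) = 1"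
    using ket_eq_unit_vec[OF p] by blast
  obtain j where j: "j < 2 ^ (2 * N)" "ket N q = unit_vec (2 ^ (2 * N)) j"
    "\<And>k. bit j k \<longleftrightarrow> k < 2 * N \<and> (if even k then bin_digit1 else bin_digit2) (q ! (k div 2)) = 1"
    using ket_eq_unit_vec[OF q] by blast
  have "p = q" if "i = j"
  proof (rule nth_equalityI)
    show "length p = length q" using p q by (simp add: configs_def)
    fix x assume "x < length p"
    hence x: "x < N" using p by (simp add: configs_def)
    have "p ! x < 4" "q ! x < 4" using configs_nth p q x by auto
    hence "bin_digit1 (p ! x) < 2" "bin_digit2 (p ! x) < 2" "bin_digit1 (q ! x) < 2" "bin_digit2 (q ! x) < 2"
      by (auto simp: bin_digit1_def bin_digit2_def)
    moreover have "bit i (2 * x) \<longleftrightarrow> bin_digit1 (p ! x) = 1" "bit i (2 * x + 1) \<longleftrightarrow> bin_digit2 (p ! x) = 1"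
      "bit j (2 * x) \<longleftrightarrow> bin_digit1 (q ! x) = 1" "bit j (2 * x + 1) \<longleftrightarrow> bin_digit2 (q ! x) = 1"
      using x by (simp_all add: i(3) j(3))
    hence "bin_digit1 (p ! x) = 1 \<longleftrightarrow> bin_digit1 (q ! x) = 1" "bin_digit2 (p ! x) = 1 \<longleftrightarrow> bin_digit2 (q ! x) = 1"
      unfolding that by simp_all
    ultimately have "bin_digit1 (p ! x) = bin_digit1 (q ! x)" "bin_digit2 (p ! x) = bin_digit2 (q ! x)"
      by (auto simp: less_2_cases_iff)
    thus "p ! x = q ! x" by (rule bin_digits_inject)
  qed
  moreover have "ket N p \<bullet>c ket N q = (if i = j then 1 else 0)"
    using i(1,2) j(1,2) by simp
  ultimately show ?thesis using i(2) j(2) i(1) j(1) by auto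
qed

lemma finite_configs: "finite (configs N)"
  using finite_lists_length_eq[of "{..<4::nat}" N] by (simp add: configs_def conj_commute)

lemma ket_carrier: "p \<in> configs N \<Longrightarrow> ket N p \<in> carrier_vec (2 ^ (2 * N))"
  by (metis ket_eq_unit_vec unit_vec_carrier)

lemma sum_swap_mult:
  fixes a :: "'a \<Rightarrow> complex"
  shows "(\<Sum>j\<in>J. (\<Sum>q\<in>Q. a q * b q j) * c j) = (\<Sum>q\<in>Q. a q * (\<Sum>j\<in>J. c j * b q j))"
  unfolding sum_distrib_left sum_distrib_right by (subst sum.swap) (simp only: mult_ac)

lemma f_op_ket:
  assumes p: "p \<in> configs N" and "x < N" "n < 4" "m < 4"
  shows "f_op N x n m *\<^sub>v ket N p =
    (if p ! x = m then (-1) ^ ((parity n + parity m) * (\<Sum>y<x. parity (p ! y))) \<cdot>\<^sub>v ket N (p[x := n])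
     else 0\<^sub>v (2 ^ (2 * N)))"
proof -
  have upd: "p[x := n] \<in> configs N"
    using p assms(3) set_update_subset_insert[of p x n] by (auto simp: configs_def)
  let ?c = "\<lambda>q. (if q ! x = m then 1 else 0) * (-1) ^ ((parity n + parity m) * (\<Sum>y<x. parity (q ! y))) :: complex"
  have "(f_op N x n m *\<^sub>v ket N p) $ i = ?c p * ket N (p[x := n]) $ i" if i: "i < 2 ^ (2 * N)" for i
  proof -
    have "(f_op N x n m *\<^sub>v ket N p) $ i =
      (\<Sum>j<2 ^ (2 * N). (\<Sum>q\<in>configs N. ?c q * ket N (q[x := n]) $ i * cnj (ket N q $ j)) * ket N p $ j)"
      using i ket_carrier[OF p] by (simp add: f_op_def scalar_prod_def atLeast0LessThan)
    also have "\<dots> = (\<Sum>q\<in>configs N. ?c q * ket N (q[x := n]) $ i * (\<Sum>j<2 ^ (2 * N). ket N p $ j * cnj (ket N q $ j)))"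
      by (rule sum_swap_mult)
    also have "\<dots> = (\<Sum>q\<in>configs N. ?c q * ket N (q[x := n]) $ i * (if p = q then 1 else 0))"
    proof (intro sum.cong refl arg_cong2[where f = "(*)"])
      fix q assume q: "q \<in> configs N"
      show "(\<Sum>j<2 ^ (2 * N). ket N p $ j * cnj (ket N q $ j)) = (if p = q then 1 else 0)"
        using ket_orthonormal[OF p q] ket_carrier[OF q] by (simp add: scalar_prod_def atLeast0LessThan)
    qed
    also have "\<dots> = ?c p * ket N (p[x := n]) $ i"
      by (subst sum.remove[OF finite_configs p], subst sum.neutral) auto
    finally show ?thesis .
  qed
  thus ?thesis using ket_carrier[OF upd] by (intro eq_vecI) (auto simp: f_op_def)
qed

end

theory Submission
  imports Defs
begin

text \<open>
  The only nonzero matrix elements of $U^{(N)}$ send a configuration to the one in which the nonzero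
  local states are moved cyclically to the next nonzero site, so $U^{(N)}$ permutes the basis up to
  signs and is unitary.  A particle alone on the ring stays in its local state, but a second one at
  an arbitrary distance replaces that state by its own.  So for the occupation number \<open>A\<close> of a
  mode of site \<open>j\<close>, the operator $U^{(N)\dagger} A U^{(N)}$ does not commute with the pair annihilator
  $a_{y,1} a_{y,2}$ of a distant site \<open>y\<close>, whereas every operator supported away from \<open>y\<close> does.
\<close>

section \<open>Cyclic motion of the nonzero entries\<close>

text \<open>Here \<open>a\<close> is the state carried from the left by the virtual bond: bond index
  \<open>\<alpha>\<close> of the tensor stands for the carry \<open>Suc \<alpha>\<close>.\<close>

fun shift_from :: "'a::zero \<Rightarrow> 'a list \<Rightarrow> 'a list" where
  "shift_from a [] = []"
| "shift_from a (m # ms) = (if m = 0 then 0 # shift_from a ms else a # shift_from m ms)"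

text \<open>The carry left over when \<open>shift_from a\<close> has run through the list, hence the
  bond state leaving on the right.\<close>

fun last_nonzero :: "'a::zero \<Rightarrow> 'a list \<Rightarrow> 'a" where
  "last_nonzero a [] = a"
| "last_nonzero a (m # ms) = last_nonzero (if m = 0 then a else m) ms"

text \<open>Serves to recover the initial carry from a shifted list, which makes the cyclic motion
  injective.\<close>

definition first_nonzero :: "'a::zero \<Rightarrow> 'a list \<Rightarrow> 'a" where
  "first_nonzero d ms = (case find (\<lambda>m. m \<noteq> 0) ms of None \<Rightarrow> d | Some m \<Rightarrow> m)"

text \<open>The initial state \<open>1\<close> is only relevant for the zero configuration, which is fixed.\<close>

definition rotate_nonzero :: "'a::zero_neq_one list \<Rightarrow> 'a list" where
  "rotate_nonzero ms = shift_from (last_nonzero 1 ms) ms"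

lemma length_shift_from [simp]: "length (shift_from a ms) = length ms"
  by (induction a ms rule: shift_from.induct) auto

lemma set_shift_from: "set (shift_from a ms) \<subseteq> insert 0 (insert a (set ms))"
  by (induction a ms rule: shift_from.induct) auto

lemma last_nonzero_in: "last_nonzero a ms \<in> insert a (set ms)"
  by (induction a ms rule: last_nonzero.induct) auto

lemma last_nonzero_neq_0: "a \<noteq> 0 \<Longrightarrow> last_nonzero a ms \<noteq> 0"
  by (induction a ms rule: last_nonzero.induct) auto

lemma last_nonzero_zeros: "set ms \<subseteq> {0} \<Longrightarrow> last_nonzero a ms = a"
  by (induction a ms rule: last_nonzero.induct) auto

lemma last_nonzero_indep: "\<not> set ms \<subseteq> {0} \<Longrightarrow> last_nonzero a ms = last_nonzero b ms"
  by (induction ms arbitrary: a b) auto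

lemma shift_from_zeros: "set ms \<subseteq> {0} \<Longrightarrow> shift_from a ms = ms"
  by (induction a ms rule: shift_from.induct) auto

text \<open>The cyclic closure condition: a run that starts with its own final carry ends with it
  again.\<close>

lemma last_nonzero_idem: "last_nonzero (last_nonzero a ms) ms = last_nonzero a ms"
  using last_nonzero_zeros last_nonzero_indep by metis

lemma first_nonzero_shift_from:
  "a \<noteq> 0 \<Longrightarrow> first_nonzero d (shift_from a ms) = (if set ms \<subseteq> {0} then d else a)"
  by (induction ms) (auto simp: first_nonzero_def)

text \<open>As carries are nonzero, the output shows which inputs vanish. At each nonzero input it
  shows the incoming carry, which is the preceding nonzero input, and the last nonzero input is the
  final carry.\<close>

lemma shift_from_inject:
  assumes "length ms = length ms'" "a \<noteq> 0" "a' \<noteq> 0"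
    and "shift_from a ms = shift_from a' ms'" "last_nonzero a ms = last_nonzero a' ms'"
  shows "a = a' \<and> ms = ms'"
  using assms
proof (induction ms ms' arbitrary: a a' rule: list_induct2)
  case (Cons m ms m' ms')
  show ?case
  proof (cases "m = 0")
    case True
    with Cons.prems have "m' = 0" by (auto split: if_splits)
    with True Cons.prems Cons.IH[of a a'] show ?thesis by simp
  next
    case False
    with Cons.prems have "m' \<noteq> 0" by (auto split: if_splits)
    with False Cons.prems Cons.IH[of m m'] show ?thesis by simp
  qed
qed simp

lemma rotate_nonzero_inject:
  assumes "length ms = length ms'" "rotate_nonzero ms = rotate_nonzero ms'"
  shows "ms = ms'"
proof -
  \<comment> \<open>The first nonzero entry receives the carry that went around the ring. For the
    zero list both sides are the default \<open>1\<close>.\<close>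
  have "first_nonzero 1 (rotate_nonzero ls) = last_nonzero 1 ls" for ls :: "'a list"
    using last_nonzero_zeros[of ls 1]
    by (simp add: rotate_nonzero_def first_nonzero_shift_from last_nonzero_neq_0)
  with assms(2) have "last_nonzero 1 ms = last_nonzero 1 ms'" by metis
  then show ?thesis
    using shift_from_inject[OF assms(1), of "last_nonzero 1 ms" "last_nonzero 1 ms'"] assms(2)
      last_nonzero_idem[of 1 ms] last_nonzero_idem[of 1 ms']
    by (simp add: rotate_nonzero_def last_nonzero_neq_0)
qed

lemma rotate_nonzero_configs: "p \<in> configs N \<Longrightarrow> rotate_nonzero p \<in> configs N"
  using set_shift_from[of "last_nonzero 1 p" p] last_nonzero_in[of 1 p]
  by (fastforce simp: configs_def rotate_nonzero_def)

section \<open>The coefficients of the operator\<close>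

lemma mult_mat_index:
  assumes "A \<in> carrier_mat l n" "B \<in> carrier_mat n k" "i < l" "j < k"
  shows "(A * B) $$ (i, j) = (\<Sum>h<n. A $$ (i, h) * B $$ (h, j))"
  using assms by (auto simp: scalar_prod_def atLeast0LessThan)

lemma U_ex_carrier [simp]: "U_ex n m \<in> carrier_mat 3 3"
  by (simp add: U_ex_def)

text \<open>Brings the tensor into the form of one step of \<open>shift_from\<close>: a zero passes
  the carry on, a nonzero \<open>m\<close> emits the carry and replaces it.\<close>

lemma U_ex_index:
  assumes "n < 4" "m < 4" "\<alpha> < 3" "\<beta> < 3"
  shows "U_ex n m $$ (\<alpha>, \<beta>) =
    of_bool (if m = 0 then n = 0 \<and> \<beta> = \<alpha> else n = Suc \<alpha> \<and> m = Suc \<beta>)"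
  using assms by (auto simp: U_ex_def)

lemma mat_prod_list_carrier:
  assumes "\<And>A. A \<in> set As \<Longrightarrow> A \<in> carrier_mat n n"
  shows "mat_prod_list n As \<in> carrier_mat n n"
  using assms by (induction As) (auto simp: mat_prod_list_def intro: mult_carrier_mat)

text \<open>For a given input and left index, a single path of bond indices can have nonzero weight,
  namely the run of carries.\<close>

lemma mat_prod_list_U_ex:
  assumes "length ns = length ms" "set ns \<subseteq> {..<4}" "set ms \<subseteq> {..<4}" "\<alpha> < 3" "\<beta> < 3"
  shows "mat_prod_list 3 (map2 U_ex ns ms) $$ (\<alpha>, \<beta>) =
    of_bool (ns = shift_from (Suc \<alpha>) ms \<and> last_nonzero (Suc \<alpha>) ms = Suc \<beta>)"
  using assms
proof (induction ns ms arbitrary: \<alpha> rule: list_induct2)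
  case Nil
  then show ?case by (simp add: mat_prod_list_def)
next
  case (Cons n ns m ms)
  define P where "P = mat_prod_list 3 (map2 U_ex ns ms)"
  have P: "P \<in> carrier_mat 3 3"
    unfolding P_def by (rule mat_prod_list_carrier) auto
  have "mat_prod_list 3 (map2 U_ex (n # ns) (m # ms)) $$ (\<alpha>, \<beta>) = (U_ex n m * P) $$ (\<alpha>, \<beta>)"
    by (simp add: mat_prod_list_def P_def)
  also have "\<dots> = (\<Sum>\<gamma><3. U_ex n m $$ (\<alpha>, \<gamma>) * P $$ (\<gamma>, \<beta>))"
    by (rule mult_mat_index[OF U_ex_carrier P Cons.prems(3,4)])
  also have "\<dots> = (\<Sum>\<gamma><3. of_bool (if m = 0 then n = 0 \<and> \<gamma> = \<alpha> else n = Suc \<alpha> \<and> m = Suc \<gamma>) *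
      of_bool (ns = shift_from (Suc \<gamma>) ms \<and> last_nonzero (Suc \<gamma>) ms = Suc \<beta>))"
    using Cons.prems Cons.IH by (intro sum.cong refl) (simp add: U_ex_index P_def)
  also have "\<dots> = of_bool (n # ns = shift_from (Suc \<alpha>) (m # ms)
      \<and> last_nonzero (Suc \<alpha>) (m # ms) = Suc \<beta>)"
  \<comment> \<open>The bond sum collapses to one term, with index \<open>\<alpha>\<close> for
    \<open>m = 0\<close> and \<open>m - 1\<close> otherwise.\<close>
  proof (cases m)
    case 0
    then show ?thesis using Cons.prems by (subst sum.remove[of _ \<alpha>]) auto
  next
    case (Suc \<gamma>)
    then show ?thesis using Cons.prems by (subst sum.remove[of _ \<gamma>]) auto
  qed
  finally show ?case .
qed

lemma Z_ex_carrier [simp]: "Z_ex \<in> carrier_mat 3 3"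
  by (simp add: Z_ex_def mat_of_rows_list_def numeral_3_eq_3)

lemma Z_ex_index:
  assumes "i < 3" "j < 3"
  shows "Z_ex $$ (i, j) = (if i = j then if i = 2 then -1 else 1 else 0)"
proof -
  have "i \<in> {0, 1, 2}" "j \<in> {0, 1, 2}" using assms by auto
  then show ?thesis by (auto simp: Z_ex_def mat_of_rows_list_def)
qed

lemma mat_trace_eq_sum: "A \<in> carrier_mat n n \<Longrightarrow> mat_trace A = (\<Sum>i<n. A $$ (i, i))"
  by (simp add: mat_trace_def diag_mat_def interv_sum_list_conv_sum_set_nat atLeast0LessThan)

lemma Z_ex_mult_index:
  assumes "P \<in> carrier_mat 3 3" "i < 3" "j < 3"
  shows "(Z_ex * P) $$ (i, j) = (if i = 2 then -1 else 1) * P $$ (i, j)"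
    and "(P * Z_ex) $$ (i, j) = (if j = 2 then -1 else 1) * P $$ (i, j)"
proof -
  show "(Z_ex * P) $$ (i, j) = (if i = 2 then -1 else 1) * P $$ (i, j)"
    unfolding mult_mat_index[OF Z_ex_carrier assms]
    using assms by (subst sum.remove[of _ i]) (auto simp: Z_ex_index intro!: sum.neutral)
  show "(P * Z_ex) $$ (i, j) = (if j = 2 then -1 else 1) * P $$ (i, j)"
    unfolding mult_mat_index[OF assms(1) Z_ex_carrier assms(2,3)]
    using assms by (subst sum.remove[of _ j]) (auto simp: Z_ex_index intro!: sum.neutral)
qed

lemma mat_trace_Z_ex_mult:
  assumes "P \<in> carrier_mat 3 3"
  shows "mat_trace (Z_ex * P) = (\<Sum>\<alpha><3. (if \<alpha> = 2 then -1 else 1) * P $$ (\<alpha>, \<alpha>))"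
  unfolding mat_trace_eq_sum[OF mult_carrier_mat[OF Z_ex_carrier assms]]
  by (intro sum.cong refl Z_ex_mult_index[OF assms]) auto

text \<open>The trace forces the initial carry to equal the final one, and \<open>Z_ex\<close>
  contributes a sign when that carry is \<open>3\<close>, which is bond index 2.\<close>

lemma trace_coefficient:
  assumes ns: "ns \<in> configs N" and ms: "ms \<in> configs N"
  shows "mat_trace (Z_ex * mat_prod_list 3 (map (\<lambda>x. U_ex (ns ! x) (ms ! x)) [0..<N])) =
    (if ns = rotate_nonzero ms then if last_nonzero 1 ms = 3 then -1 else 1 else 0)"
proof -
  have len: "length ns = N" "length ms = N" "set ns \<subseteq> {..<4}" "set ms \<subseteq> {..<4}"
    using ns ms by (auto simp: configs_def)
  have map: "map (\<lambda>x. U_ex (ns ! x) (ms ! x)) [0..<N] = map2 U_ex ns ms"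
    using len by (intro nth_equalityI) auto
  have "mat_trace (Z_ex * mat_prod_list 3 (map2 U_ex ns ms)) =
    (\<Sum>\<alpha><3. (if \<alpha> = 2 then -1 else 1) *
      of_bool (ns = shift_from (Suc \<alpha>) ms \<and> last_nonzero (Suc \<alpha>) ms = Suc \<alpha>))"
    using len by (subst mat_trace_Z_ex_mult)
      (auto simp: mat_prod_list_U_ex intro!: mat_prod_list_carrier sum.cong)
  also have "\<dots> = (if ns = rotate_nonzero ms then if last_nonzero 1 ms = 3 then -1 else 1 else 0)"
  proof (cases "set ms \<subseteq> {0}")
    \<comment> \<open>For the zero configuration all three carries close up, and the diagonal of
      \<open>Z_ex\<close> sums to 1 + 1 - 1 = 1. The default \<open>1\<close> of
      \<open>last_nonzero\<close> gives the same value on the right.\<close>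
    case True
    then show ?thesis
      by (simp add: shift_from_zeros last_nonzero_zeros rotate_nonzero_def numeral_3_eq_3)
  next
    case False
    define l where "l = last_nonzero 1 ms"
    \<comment> \<open>With a nonzero entry present the final carry is independent of the initial
      one, so just the bond index \<open>l - 1\<close> survives in the trace.\<close>
    have l: "last_nonzero a ms = l" for a using last_nonzero_indep[OF False] l_def by metis
    have "l \<noteq> 0" unfolding l_def by (rule last_nonzero_neq_0) simp
    moreover have "l < 4" using last_nonzero_in[of 1 ms] len(4) by (auto simp: l_def)
    ultimately have "l \<in> {1, 2, 3}" by auto
    then show ?thesis
      by (auto simp: rotate_nonzero_def l numeral_3_eq_3 numeral_2_eq_2)
  qed
  finally show ?thesis by (simp only: map)
qed

section \<open>Action on the basis\<close>

lemma mult_mat_zero_vec: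
  fixes A :: "'a :: semiring_0 mat"
  shows "A \<in> carrier_mat m n \<Longrightarrow> A *\<^sub>v 0\<^sub>v n = 0\<^sub>v m"
  by (intro eq_vecI) auto

lemma f_op_carrier [simp]: "f_op N x n m \<in> carrier_mat (2 ^ (2 * N)) (2 ^ (2 * N))"
  by (simp add: f_op_def)

text \<open>Each factor sends a basis vector to a signed basis vector or to zero. The sign is left
  unspecified, since orthonormality and the commutation argument work with any signs.\<close>

lemma f_op_product_ket:
  assumes ns: "ns \<in> configs N" and ms: "ms \<in> configs N" and p: "p \<in> configs N"
  obtains c :: complex where "c = 1 \<or> c = -1"
    "mat_prod_list (2 ^ (2 * N)) (map (\<lambda>x. f_op N x (ns ! x) (ms ! x)) [0..<N]) *\<^sub>v ket N p =
      (if p = ms then c \<cdot>\<^sub>v ket N ns else 0\<^sub>v (2 ^ (2 * N)))"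
proof -
  let ?F = "\<lambda>s. mat_prod_list (2 ^ (2 * N)) (map (\<lambda>x. f_op N x (ns ! x) (ms ! x)) [s..<N])"
  have F: "?F s \<in> carrier_mat (2 ^ (2 * N)) (2 ^ (2 * N))" for s
    by (rule mat_prod_list_carrier) auto
  have len: "length ns = N" "length ms = N" "length p = N" "set ns \<subseteq> {..<4}" "set p \<subseteq> {..<4}"
    using ns ms p by (auto simp: configs_def)
  \<comment> \<open>The rightmost factor acts first, so the induction runs from the last site down:
    the sites from \<open>s\<close> on already carry \<open>ns\<close>, the earlier ones still carry
    \<open>p\<close>.\<close>
  have "\<exists>c. (c = 1 \<or> c = -1) \<and> ?F s *\<^sub>v ket N p =
      (if drop s p = drop s ms then c \<cdot>\<^sub>v ket N (take s p @ drop s ns) else 0\<^sub>v (2 ^ (2 * N)))"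
    if "s \<le> N" for s using that
  proof (induction rule: inc_induct)
    case base
    show ?case using len ket_carrier[OF p]
      by (intro exI[of _ 1]) (auto simp: mat_prod_list_def)
  next
    case (step s)
    then obtain c where c: "c = 1 \<or> c = -1" "?F (Suc s) *\<^sub>v ket N p =
      (if drop (Suc s) p = drop (Suc s) ms then c \<cdot>\<^sub>v ket N (take (Suc s) p @ drop (Suc s) ns)
       else 0\<^sub>v (2 ^ (2 * N)))" by blast
    have "?F s = f_op N s (ns ! s) (ms ! s) * ?F (Suc s)"
      using step(2) by (simp add: upt_conv_Cons mat_prod_list_def)
    hence Fs: "?F s *\<^sub>v ket N p = f_op N s (ns ! s) (ms ! s) *\<^sub>v (?F (Suc s) *\<^sub>v ket N p)"
      by (simp add: assoc_mult_mat_vec[OF f_op_carrier F ket_carrier[OF p]])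
    define q where "q = take (Suc s) p @ drop (Suc s) ns"
    have q: "q \<in> configs N"
      using len step(2) set_take_subset[of "Suc s" p] set_drop_subset[of "Suc s" ns]
      by (auto simp: q_def configs_def)
    have qs: "q ! s = p ! s" "q[s := ns ! s] = take s p @ drop s ns"
      using len step(2)
      by (auto simp: q_def nth_append take_Suc_conv_app_nth list_update_append Cons_nth_drop_Suc)
    have drops: "drop s p = p ! s # drop (Suc s) p" "drop s ms = ms ! s # drop (Suc s) ms"
      using len step(2) by (simp_all add: Cons_nth_drop_Suc)
    define d :: complex where "d = (-1) ^ ((parity (ns ! s) + parity (ms ! s)) * (\<Sum>y<s. parity (q ! y)))"
    have d: "d = 1 \<or> d = -1" unfolding d_def by (simp add: minus_one_power_iff)
    have f: "f_op N s (ns ! s) (ms ! s) *\<^sub>v ket N q =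
      (if p ! s = ms ! s then d \<cdot>\<^sub>v ket N (take s p @ drop s ns) else 0\<^sub>v (2 ^ (2 * N)))"
      using f_op_ket[OF q step(2) configs_nth[OF ns step(2)] configs_nth[OF ms step(2)]]
      by (simp add: qs d_def)
    have "?F s *\<^sub>v ket N p = (if drop s p = drop s ms then (c * d) \<cdot>\<^sub>v ket N (take s p @ drop s ns)
        else 0\<^sub>v (2 ^ (2 * N)))"
      unfolding Fs c(2) drops q_def[symmetric]
      by (auto simp: mult_mat_vec[OF f_op_carrier ket_carrier[OF q]] f smult_smult_assoc
          mult_mat_zero_vec[OF f_op_carrier])
    with c(1) d show ?case by (intro exI[of _ "c * d"]) auto
  qed
  from this[of 0, OF le0] show ?thesis
    unfolding drop_0 take_0 append_Nil using that by blast
qed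

text \<open>One term of the double sum survives: the operator product selects \<open>ms = p\<close>,
  and the trace then selects \<open>ns = rotate_nonzero p\<close>.\<close>

lemma fMPO_ex_ket:
  assumes p: "p \<in> configs N"
  obtains c :: complex where "c = 1 \<or> c = -1"
    "fMPO 3 Z_ex U_ex N *\<^sub>v ket N p = c \<cdot>\<^sub>v ket N (rotate_nonzero p)"
proof -
  let ?T = "\<lambda>ns ms. mat_trace (Z_ex * mat_prod_list 3 (map (\<lambda>x. U_ex (ns ! x) (ms ! x)) [0..<N]))"
  let ?F = "\<lambda>ns ms. mat_prod_list (2 ^ (2 * N)) (map (\<lambda>x. f_op N x (ns ! x) (ms ! x)) [0..<N])"
  let ?r = "rotate_nonzero p"
  have r: "?r \<in> configs N" by (rule rotate_nonzero_configs[OF p])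
  have F: "?F ns ms \<in> carrier_mat (2 ^ (2 * N)) (2 ^ (2 * N))" for ns ms
    by (rule mat_prod_list_carrier) auto
  obtain j where j: "j < 2 ^ (2 * N)" "ket N p = unit_vec (2 ^ (2 * N)) j"
    using ket_eq_unit_vec[OF p] by blast
  obtain c where c: "c = 1 \<or> c = -1" "?F ?r p *\<^sub>v ket N p = c \<cdot>\<^sub>v ket N ?r"
    using f_op_product_ket[OF r p p] by auto
  define t :: complex where "t = (if last_nonzero 1 p = 3 then -1 else 1)"
  have entry: "?F ns ms $$ (i, j) = (?F ns ms *\<^sub>v ket N p) $ i" if "i < 2 ^ (2 * N)" for i ns ms
    using that j F[of ns ms] by simp
  have "(fMPO 3 Z_ex U_ex N *\<^sub>v ket N p) $ i = ((t * c) \<cdot>\<^sub>v ket N ?r) $ i" if i: "i < 2 ^ (2 * N)" for i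
  proof -
    have "(fMPO 3 Z_ex U_ex N *\<^sub>v ket N p) $ i =
      (\<Sum>ns\<in>configs N. \<Sum>ms\<in>configs N. ?T ns ms * ?F ns ms $$ (i, j))"
      using i j by (simp add: fMPO_def)
    also have "\<dots> = (\<Sum>ns\<in>configs N. \<Sum>ms\<in>configs N.
        if ns = ?r \<and> ms = p then t * c * ket N ?r $ i else 0)"
    proof (intro sum.cong refl)
      fix ns ms assume nm: "ns \<in> configs N" "ms \<in> configs N"
      show "?T ns ms * ?F ns ms $$ (i, j) = (if ns = ?r \<and> ms = p then t * c * ket N ?r $ i else 0)"
      proof (cases "ms = p")
        case True
        then show ?thesis
          using c(2) ket_carrier[OF r] i
          unfolding entry[OF i] trace_coefficient[OF nm] by (auto simp: t_def)
      next
        case False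
        then have "?F ns ms *\<^sub>v ket N p = 0\<^sub>v (2 ^ (2 * N))"
          using f_op_product_ket[OF nm p] by metis
        with False i show ?thesis by (simp add: entry)
      qed
    qed
    also have "\<dots> = (\<Sum>ns\<in>configs N. if ns = ?r then t * c * ket N ?r $ i else 0)"
      by (intro sum.cong refl) (simp add: p finite_configs)
    also have "\<dots> = t * c * ket N ?r $ i"
      by (simp add: r finite_configs)
    finally show ?thesis using i ket_carrier[OF r] by simp
  qed
  then have "fMPO 3 Z_ex U_ex N *\<^sub>v ket N p = (t * c) \<cdot>\<^sub>v ket N ?r"
    using ket_carrier[OF r] by (intro eq_vecI) (auto simp: fMPO_def)
  moreover have "t * c = 1 \<or> t * c = -1" using c(1) by (auto simp: t_def)
  ultimately show ?thesis using that by blast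
qed

section \<open>Unitarity\<close>

text \<open>By counting: orthonormality makes the kets distinct, and there are as many
  configurations as unit vectors.\<close>

lemma ket_surj:
  assumes "i < 2 ^ (2 * N)"
  obtains p where "p \<in> configs N" "ket N p = unit_vec (2 ^ (2 * N)) i"
proof -
  have inj: "inj_on (ket N) (configs N)"
    using ket_orthonormal by (intro inj_onI) (metis zero_neq_one)
  have "ket N ` configs N \<subseteq> unit_vec (2 ^ (2 * N)) ` {..<2 ^ (2 * N)}"
    by (auto elim!: ket_eq_unit_vec)
  moreover have "card (configs N) = 2 ^ (2 * N)"
    using card_lists_length_eq[of "{..<4::nat}" N] by (simp add: configs_def conj_commute power_mult)
  hence "card (unit_vec (2 ^ (2 * N)) ` {..<2 ^ (2 * N)} :: complex vec set) \<le> card (ket N ` configs N)"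
    using card_image_le[of "{..<2 ^ (2 * N)}" "unit_vec (2 ^ (2 * N)) :: nat \<Rightarrow> complex vec"]
    by (simp add: card_image[OF inj])
  ultimately have "ket N ` configs N = unit_vec (2 ^ (2 * N)) ` {..<2 ^ (2 * N)}"
    by (intro card_seteq) auto
  with assms that show ?thesis by (metis imageE imageI lessThan_iff)
qed

lemma fMPO_carrier [simp]: "fMPO D Z U N \<in> carrier_mat (2 ^ (2 * N)) (2 ^ (2 * N))"
  by (simp add: fMPO_def)

lemma mat_adjoint_mult_index:
  assumes "A \<in> carrier_mat n n" "i < n" "j < n"
  shows "(mat_adjoint A * A) $$ (i, j) = (A *\<^sub>v unit_vec n j) \<bullet>c (A *\<^sub>v unit_vec n (i :: nat) :: complex vec)"
proof -
  have "A *\<^sub>v unit_vec n k = col A k" if "k < n" for k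
    using assms(1) that by (intro eq_vecI) auto
  then show ?thesis
    using assms by (auto simp: mat_adjoint_index scalar_prod_def mult.commute
        simp del: index_mult_mat_vec intro!: sum.cong)
qed

text \<open>Since the rotation is injective, basis vectors go to signed, pairwise distinct basis
  vectors, so the Gram matrix of the images is the identity. For a square matrix a left inverse is
  also a right inverse.\<close>

lemma unitary_fMPO_ex: "unitary_mat (2 ^ (2 * N)) (fMPO 3 Z_ex U_ex N)"
proof -
  let ?d = "2 ^ (2 * N)" and ?U = "fMPO 3 Z_ex U_ex N"
  note A = mat_adjoint_carrier[OF fMPO_carrier[of 3 Z_ex U_ex N]]
  have left: "mat_adjoint ?U * ?U = 1\<^sub>m ?d"
  proof (rule eq_matI)
    fix i j assume "i < dim_row (1\<^sub>m ?d :: complex mat)" "j < dim_col (1\<^sub>m ?d :: complex mat)"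
    hence ij: "i < ?d" "j < ?d" by auto
    obtain p where p: "p \<in> configs N" "ket N p = unit_vec ?d i" using ket_surj[OF ij(1)] by metis
    obtain q where q: "q \<in> configs N" "ket N q = unit_vec ?d j" using ket_surj[OF ij(2)] by metis
    obtain c where c: "c = 1 \<or> c = -1" "?U *\<^sub>v ket N p = c \<cdot>\<^sub>v ket N (rotate_nonzero p)"
      using fMPO_ex_ket[OF p(1)] by metis
    obtain d where d: "d = 1 \<or> d = -1" "?U *\<^sub>v ket N q = d \<cdot>\<^sub>v ket N (rotate_nonzero q)"
      using fMPO_ex_ket[OF q(1)] by metis
    note rp = rotate_nonzero_configs[OF p(1)] and rq = rotate_nonzero_configs[OF q(1)]
    have inj: "rotate_nonzero q = rotate_nonzero p \<longleftrightarrow> q = p"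
      using p(1) q(1) rotate_nonzero_inject[of q p] by (auto simp: configs_def)
    have ij_eq: "q = p \<longleftrightarrow> i = j"
      using ket_orthonormal[OF q(1) p(1)] p(2) q(2) ij by (auto split: if_splits)
    have "(mat_adjoint ?U * ?U) $$ (i, j) = (?U *\<^sub>v ket N q) \<bullet>c (?U *\<^sub>v ket N p)"
      using mat_adjoint_mult_index[OF fMPO_carrier ij] p(2) q(2) by simp
    also have "\<dots> = d * cnj c * (ket N (rotate_nonzero q) \<bullet>c ket N (rotate_nonzero p))"
      unfolding c(2) d(2) using ket_carrier[OF rp] ket_carrier[OF rq]
      by (simp add: conjugate_smult_vec)
    also have "\<dots> = (if i = j then d * cnj c else 0)"
      by (simp add: ket_orthonormal[OF rq rp] inj ij_eq)
    also have "\<dots> = 1\<^sub>m ?d $$ (i, j)"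
    proof (cases "i = j")
      case True
      hence "q = p" using ij_eq by simp
      \<comment> \<open>The signs \<open>c\<close> and \<open>d\<close> were obtained separately.
        For \<open>q = p\<close> they scale the same nonzero vector to the same image, so they
        agree.\<close>
      hence "c \<cdot>\<^sub>v ket N (rotate_nonzero p) = d \<cdot>\<^sub>v ket N (rotate_nonzero p)" using c d by simp
      hence "c * (ket N (rotate_nonzero p) \<bullet>c ket N (rotate_nonzero p))
          = d * (ket N (rotate_nonzero p) \<bullet>c ket N (rotate_nonzero p))"
        using ket_carrier[OF rp] by (metis smult_scalar_prod_distrib carrier_vec_conjugate)
      hence "c = d" by (simp add: ket_orthonormal[OF rp rp])
      with True ij c(1) show ?thesis by auto
    qed (use ij in auto)
    finally show "(mat_adjoint ?U * ?U) $$ (i, j) = 1\<^sub>m ?d $$ (i, j)" .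
  qed (use A in auto)
  show ?thesis
    unfolding unitary_mat_def
    using left mat_mult_left_right_inverse[OF A fMPO_carrier left] by simp
qed

section \<open>Failure of locality\<close>

text \<open>The matrices commuting with \<open>C\<close> form a unital algebra, so checking the
  generators suffices.\<close>

lemma generated_algebra_commute:
  assumes "B \<in> generated_algebra n S" "C \<in> carrier_mat n n"
    and "\<And>G. G \<in> S \<Longrightarrow> G \<in> carrier_mat n n" "\<And>G. G \<in> S \<Longrightarrow> G * C = C * G"
  shows "B \<in> carrier_mat n n \<and> B * C = C * B"
  using assms(1)
proof induction
  case (smult A c)
  then show ?case using assms(2)
    by (simp add: mult_smult_assoc_mat[of _ n n _ n] mult_smult_distrib[of _ n n _ n])
next
  case (add A B)
  then show ?case using assms(2)
    by (simp add: add_mult_distrib_mat[of _ n n _ _ n] mult_add_distrib_mat[of _ n n _ n])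
next
  case (mult A B)
  then have carrier: "A \<in> carrier_mat n n" "B \<in> carrier_mat n n"
    and comm: "A * C = C * A" "B * C = C * B" by auto
  have "A * B * C = A * C * B"
    using carrier assms(2) by (simp add: comm(2) assoc_mult_mat[of _ n n _ n _ n])
  also have "\<dots> = C * (A * B)"
    using carrier assms(2) by (simp add: comm(1) assoc_mult_mat[of _ n n _ n _ n])
  finally show ?case using carrier by simp
qed (use assms in auto)

text \<open>Moving \<open>G\<close> past \<open>A\<close> and then past \<open>B\<close> produces
  two signs, which cancel.\<close>

lemma anticommuting_pair_commute:
  fixes G :: "complex mat"
  assumes "G \<in> carrier_mat n n" "A \<in> carrier_mat n n" "B \<in> carrier_mat n n"
    and "G * A + A * G = 0\<^sub>m n n" "G * B + B * G = 0\<^sub>m n n"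
  shows "G * (A * B) = A * B * G"
proof -
  have neg: "G * X = - (X * G)" if "X \<in> carrier_mat n n" "G * X + X * G = 0\<^sub>m n n" for X
  proof (rule eq_matI)
    fix i j assume "i < dim_row (- (X * G))" "j < dim_col (- (X * G))"
    hence ij: "i < n" "j < n" using that assms(1) by auto
    have "(G * X) $$ (i, j) + (X * G) $$ (i, j) = (G * X + X * G) $$ (i, j)"
      using ij that(1) assms(1) by (simp del: index_mult_mat(1))
    also have "\<dots> = 0" using ij that(2) by simp
    finally show "(G * X) $$ (i, j) = (- (X * G)) $$ (i, j)"
      using ij that(1) assms(1) by (simp add: eq_neg_iff_add_eq_0 del: index_mult_mat(1))
  qed (use that assms(1) in auto)
  have "G * (A * B) = G * A * B" using assms by (simp add: assoc_mult_mat[of _ n n _ n _ n])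
  also have "\<dots> = - (A * (G * B))"
    using assms neg[OF assms(2,4)] by (simp add: assoc_mult_mat[of _ n n _ n _ n])
  also have "\<dots> = A * (B * G)"
    using assms neg[OF assms(3,5)] by simp
  finally show ?thesis using assms by (simp add: assoc_mult_mat[of _ n n _ n _ n])
qed

text \<open>A pair is used because it is an even operator: the modes of other sites anticommute with
  each of its factors and therefore commute with the product.\<close>

lemma local_algebra_commute_pair:
  assumes B: "B \<in> local_algebra N R" and R: "R \<subseteq> {..<N}" "y \<notin> R" and y: "y < N"
  shows "B * (site_annihilation N y 1 * site_annihilation N y 2) =
    site_annihilation N y 1 * site_annihilation N y 2 * B"
proof -
  let ?d = "2 ^ (2 * N)"
  let ?S = "\<Union>x\<in>R. \<Union>i\<in>{1, 2}. {site_annihilation N x i, mat_adjoint (site_annihilation N x i)}"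
  let ?C = "site_annihilation N y 1 * site_annihilation N y 2"
  have S: "G \<in> carrier_mat ?d ?d \<and> G * ?C = ?C * G" if "G \<in> ?S" for G
  proof -
    from that obtain x i where x: "x \<in> R" "i \<in> {1, 2}"
      and G: "G = site_annihilation N x i \<or> G = mat_adjoint (site_annihilation N x i)" by blast
    from x R have xN: "x < N" "x \<noteq> y" by auto
    have carrier: "G \<in> carrier_mat ?d ?d" using G by (auto intro: mat_adjoint_carrier)
    have "G * site_annihilation N y k + site_annihilation N y k * G = 0\<^sub>m ?d ?d" if k: "k \<in> {1, 2}" for k
    proof -
      have modes: "2 * x + (i - 1) < 2 * N" "2 * y + (k - 1) \<noteq> 2 * x + (i - 1)"
        using xN x(2) k by auto
      show ?thesis
      proof (rule disjE[OF G])
        assume "G = site_annihilation N x i"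
        then show ?thesis by (simp add: site_annihilation_def CAR_annihilation)
      next
        assume G': "G = mat_adjoint (site_annihilation N x i)"
        have "site_annihilation N y k * G + G * site_annihilation N y k = 0\<^sub>m ?d ?d"
          unfolding G' site_annihilation_def using CAR_creation[OF modes(1)] modes(2) by simp
        then show ?thesis
          by (subst comm_add_mat[of _ ?d ?d])
            (use carrier in \<open>auto intro: mult_carrier_mat[where n = ?d]\<close>)
      qed
    qed
    then have "G * ?C = ?C * G" by (intro anticommuting_pair_commute[OF carrier]) auto
    with carrier show ?thesis by simp
  qed
  show ?thesis
    using generated_algebra_commute[OF B[unfolded local_algebra_def]
        mult_carrier_mat[OF site_annihilation_carrier site_annihilation_carrier]] S by auto
qed

section \<open>Occupation number and pair annihilator on basis states\<close>

lemma number_operator_unit_vec: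
  assumes "j < 2 ^ M" "k < M"
  shows "mat_adjoint (annihilation M k) * annihilation M k *\<^sub>v unit_vec (2 ^ M) j =
    (if bit j k then unit_vec (2 ^ M) j else 0\<^sub>v (2 ^ M))"
proof -
  note C = mat_adjoint_carrier[OF annihilation_carrier[of M k]]
  show ?thesis
    using assms
    by (auto simp: mult_mat_zero_vec[OF C] assoc_mult_mat_vec[OF C annihilation_carrier] annihilation_unit_vec mult_mat_vec[OF C]
        creation_unit_vec unset_bit_less bit_simps jw_sign_unset_bit jw_sign_square smult_smult_assoc
        set_unset_bit)
qed

lemma site_number_operator_ket:
  assumes "p \<in> configs N" "x < N"
  shows "mat_adjoint (site_annihilation N x 1) * site_annihilation N x 1 *\<^sub>v ket N p =
    (if bin_digit1 (p ! x) = 1 then ket N p else 0\<^sub>v (2 ^ (2 * N)))"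
proof -
  obtain i where i: "i < 2 ^ (2 * N)" "ket N p = unit_vec (2 ^ (2 * N)) i"
    "\<And>k. bit i k \<longleftrightarrow> k < 2 * N \<and> (if even k then bin_digit1 else bin_digit2) (p ! (k div 2)) = 1"
    using ket_eq_unit_vec[OF assms(1)] by blast
  then show ?thesis
    using number_operator_unit_vec[OF i(1), of "2 * x"] assms(2) by (simp add: site_annihilation_def)
qed

text \<open>State \<open>3\<close> has both modes occupied, so the pair annihilator empties the site
  up to a sign. This removes one of two particles and leaves the other alone on the ring.\<close>

lemma pair_annihilation_ket:
  assumes p: "p \<in> configs N" and y: "y < N" "p ! y = 3"
  obtains c :: complex where "c \<noteq> 0"
    "site_annihilation N y 1 * site_annihilation N y 2 *\<^sub>v ket N p = c \<cdot>\<^sub>v ket N (p[y := 0])"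
proof -
  let ?d = "2 ^ (2 * N)" and ?a = "annihilation (2 * N) (2 * y)" and ?b = "annihilation (2 * N) (Suc (2 * y))"
  have q: "p[y := 0] \<in> configs N"
    using p set_update_subset_insert[of p y 0] by (auto simp: configs_def)
  obtain i where i: "i < ?d" "ket N p = unit_vec ?d i"
    "\<And>k. bit i k \<longleftrightarrow> k < 2 * N \<and> (if even k then bin_digit1 else bin_digit2) (p ! (k div 2)) = 1"
    using ket_eq_unit_vec[OF p] by blast
  obtain j where j: "j < ?d" "ket N (p[y := 0]) = unit_vec ?d j"
    "\<And>k. bit j k \<longleftrightarrow> k < 2 * N \<and> (if even k then bin_digit1 else bin_digit2) (p[y := 0] ! (k div 2)) = 1"
    using ket_eq_unit_vec[OF q] by blast
  define h where "h = unset_bit (Suc (2 * y)) i"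
  have bits: "bit i (2 * y)" "bit i (Suc (2 * y))" "bit h (2 * y)"
    using y by (simp_all add: h_def bit_simps i(3) bin_digit1_def bin_digit2_def)
  have "j = unset_bit (2 * y) h"
  proof (rule bit_eqI)
    fix k
    have len: "length p = N" using p by (simp add: configs_def)
    consider "k = 2 * y" | "k = Suc (2 * y)" | "k div 2 \<noteq> y" by linarith
    then show "bit j k = bit (unset_bit (2 * y) h) k"
      by cases (use y len in \<open>auto simp: h_def bit_simps i(3) j(3) bin_digit1_def bin_digit2_def\<close>)
  qed
  moreover have "h < ?d" unfolding h_def by (rule unset_bit_less[OF i(1)])
  moreover have "?a * ?b *\<^sub>v unit_vec ?d i = ?a *\<^sub>v (jw_sign (Suc (2 * y)) i \<cdot>\<^sub>v unit_vec ?d h)"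
    using bits by (simp add: assoc_mult_mat_vec[OF annihilation_carrier annihilation_carrier]
        annihilation_unit_vec[OF i(1)] h_def)
  ultimately have "?a * ?b *\<^sub>v unit_vec ?d i = (jw_sign (Suc (2 * y)) i * jw_sign (2 * y) h) \<cdot>\<^sub>v unit_vec ?d j"
    using bits by (simp add: mult_mat_vec[OF annihilation_carrier] annihilation_unit_vec smult_smult_assoc)
  then show ?thesis
    by (intro that[of "jw_sign (Suc (2 * y)) i * jw_sign (2 * y) h"])
      (auto simp: i(2) j(2) site_annihilation_def jw_sign_def)
qed

section \<open>Influence of a distant particle\<close>

lemma shift_from_replicate_0: "shift_from a (replicate k 0 @ ms) = replicate k 0 @ shift_from a ms"
  by (induction k) auto

lemma last_nonzero_replicate_0: "last_nonzero a (replicate k 0 @ ms) = last_nonzero a ms"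
  by (induction k) auto

lemma not_locality_preserving_fMPO_ex: "\<not> locality_preserving (fMPO 3 Z_ex U_ex)"
proof
  assume "locality_preserving (fMPO 3 Z_ex U_ex)"
  then obtain r where r: "\<And>N j A. N \<ge> 1 \<Longrightarrow> j < N \<Longrightarrow> A \<in> local_algebra N {j} \<Longrightarrow>
      mat_adjoint (fMPO 3 Z_ex U_ex N) * A * fMPO 3 Z_ex U_ex N
        \<in> local_algebra N {x. x < N \<and> ring_dist N j x \<le> r}"
    unfolding locality_preserving_def by blast
  \<comment> \<open>The two ways around the ring from \<open>j\<close> to site 0 have lengths
    \<open>r + 1\<close> and \<open>r + 2\<close>, so site 0 lies just outside the range
    \<open>r\<close>.\<close>
  define N where "N = 2 * r + 3"
  define j where "j = Suc r"
  \<comment> \<open>In \<open>p\<close> there is a \<open>3\<close> at site 0 and a \<open>1\<close>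
    at site \<open>j\<close>; the rotation exchanges them, giving \<open>p'\<close>. Emptying site 0
    of \<open>p\<close> gives \<open>q\<close>, whose lone particle the rotation fixes.\<close>
  define p where "p = (3::nat) # replicate r 0 @ 1 # replicate (Suc r) 0"
  define q where "q = (0::nat) # replicate r 0 @ 1 # replicate (Suc r) 0"
  define p' where "p' = (1::nat) # replicate r 0 @ 3 # replicate (Suc r) 0"
  let ?d = "2 ^ (2 * N)" and ?U = "fMPO 3 Z_ex U_ex N"
  define A where "A = mat_adjoint (site_annihilation N j 1) * site_annihilation N j 1"
  define C where "C = site_annihilation N 0 1 * site_annihilation N 0 2"
  define B where "B = mat_adjoint ?U * A * ?U"
  have jN: "j < N" "0 < N" by (simp_all add: j_def N_def)
  have configs: "p \<in> configs N" "q \<in> configs N" "p' \<in> configs N"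
    by (auto simp: p_def q_def p'_def configs_def N_def)
  have zeros: "last_nonzero a (replicate k 0) = a" "shift_from a (replicate k 0) = replicate k 0"
    for a :: nat and k by (auto intro!: last_nonzero_zeros shift_from_zeros)
  have rotate: "rotate_nonzero p = p'" "rotate_nonzero q = q"
    by (simp_all add: p_def q_def p'_def rotate_nonzero_def shift_from_replicate_0
        last_nonzero_replicate_0 zeros)
  \<comment> \<open>State \<open>3\<close> occupies the first mode of its site and state
    \<open>1\<close> does not, so \<open>A\<close> tells \<open>p'\<close> from
    \<open>q\<close>.\<close>
  have digits: "bin_digit1 (p' ! j) = 1" "bin_digit1 (q ! j) \<noteq> 1"
    by (simp_all add: p'_def q_def j_def nth_append bin_digit1_def)
  have carriers: "A \<in> carrier_mat ?d ?d" "C \<in> carrier_mat ?d ?d" "?U \<in> carrier_mat ?d ?d"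
    "mat_adjoint ?U \<in> carrier_mat ?d ?d"
    by (auto simp: A_def C_def intro!: mat_adjoint_carrier mult_carrier_mat[where n = ?d])
  note kets = configs[THEN ket_carrier]
  have smult_zero: "c \<cdot>\<^sub>v 0\<^sub>v ?d = 0\<^sub>v ?d" for c :: complex by (intro eq_vecI) auto
  have A_vec: "A *\<^sub>v ket N p' = ket N p'" "A *\<^sub>v ket N q = 0\<^sub>v ?d"
    using site_number_operator_ket[OF configs(3) jN(1)] site_number_operator_ket[OF configs(2) jN(1)] digits
    unfolding A_def by simp_all
  have B_vec: "B *\<^sub>v v = mat_adjoint ?U *\<^sub>v (A *\<^sub>v (?U *\<^sub>v v))" if "v \<in> carrier_vec ?d" for v
    unfolding B_def using that carriers
    by (simp add: assoc_mult_mat_vec[of _ ?d ?d _ ?d] mult_mat_vec_carrier[of _ ?d ?d])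
  have unitary: "mat_adjoint ?U *\<^sub>v (?U *\<^sub>v v) = v" if "v \<in> carrier_vec ?d" for v
    using unitary_fMPO_ex[of N] that carriers
    by (simp add: unitary_mat_def flip: assoc_mult_mat_vec[of _ ?d ?d _ ?d])

  have "A \<in> local_algebra N {j}"
    unfolding A_def local_algebra_def by (intro generated_algebra.mult generated_algebra.gen) auto
  with r[of N j A] jN have "B \<in> local_algebra N {x. x < N \<and> ring_dist N j x \<le> r}"
    by (simp add: B_def)
  moreover have "\<not> ring_dist N j 0 \<le> r" by (simp add: ring_dist_def N_def j_def)
  ultimately have comm: "B * C = C * B"
    unfolding C_def by (intro local_algebra_commute_pair) (use jN in auto)

  have "B *\<^sub>v ket N p = ket N p"
  proof -
    obtain c where "?U *\<^sub>v ket N p = c \<cdot>\<^sub>v ket N p'"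
      using fMPO_ex_ket[OF configs(1)] rotate by metis
    moreover from this have "A *\<^sub>v (?U *\<^sub>v ket N p) = ?U *\<^sub>v ket N p"
      using kets by (simp add: mult_mat_vec[OF carriers(1)] A_vec)
    ultimately show ?thesis using unitary[OF kets(1)] B_vec[OF kets(1)] by simp
  qed
  moreover have "B *\<^sub>v ket N q = 0\<^sub>v ?d"
  proof -
    obtain c where "?U *\<^sub>v ket N q = c \<cdot>\<^sub>v ket N q"
      using fMPO_ex_ket[OF configs(2)] rotate by metis
    then have "A *\<^sub>v (?U *\<^sub>v ket N q) = 0\<^sub>v ?d"
      using kets by (simp add: mult_mat_vec[OF carriers(1)] A_vec smult_zero)
    then show ?thesis using B_vec[OF kets(2)] by (simp add: mult_mat_zero_vec[OF carriers(4)])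
  qed
  moreover obtain c where c: "c \<noteq> 0" "C *\<^sub>v ket N p = c \<cdot>\<^sub>v ket N q"
    using pair_annihilation_ket[OF configs(1) jN(2)] unfolding C_def p_def q_def by auto
  moreover have B: "B \<in> carrier_mat ?d ?d"
    unfolding B_def using carriers by (auto intro!: mult_carrier_mat[where n = ?d])
  \<comment> \<open>The contradiction: removing the particle at site 0 first leads to
    \<open>q\<close>, where \<open>B\<close> gives zero, while in the other order \<open>B\<close>
    fixes \<open>ket N p\<close> and \<open>C\<close> leaves \<open>c\<close> times
    \<open>ket N q\<close>.\<close>
  moreover have "B *\<^sub>v (C *\<^sub>v ket N p) = C *\<^sub>v (B *\<^sub>v ket N p)"
    by (simp add: comm flip: assoc_mult_mat_vec[OF B carriers(2) kets(1)]
        assoc_mult_mat_vec[OF carriers(2) B kets(1)])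
  ultimately have "c \<cdot>\<^sub>v ket N q = 0\<^sub>v ?d"
    using kets by (simp add: mult_mat_vec[OF B] smult_zero)
  then have "c * (ket N q \<bullet>c ket N q) = 0"
    using kets by (metis smult_scalar_prod_distrib carrier_vec_conjugate scalar_prod_left_zero)
  with c(1) show False by (simp add: ket_orthonormal[OF configs(2,2)])
qed

section \<open>Parity grading of the tensor, and conclusion\<close>

text \<open>The entry of \<open>Z_ex\<close> at index \<open>\<alpha>\<close> is minus the parity
  sign of state \<open>Suc \<alpha>\<close>. The extra minus cancels between the two sides for
  nonzero \<open>n\<close> and \<open>m\<close>, and \<open>U_ex 0 0\<close> is the
  identity.\<close>

lemma graded_U_ex:
  assumes "n < 4" "m < 4"
  shows "Z_ex * U_ex n m = (-1) ^ (parity n + parity m) \<cdot>\<^sub>m (U_ex n m * Z_ex)"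
proof (rule eq_matI)
  fix i j assume "i < dim_row ((-1) ^ (parity n + parity m) \<cdot>\<^sub>m (U_ex n m * Z_ex))"
    "j < dim_col ((-1) ^ (parity n + parity m) \<cdot>\<^sub>m (U_ex n m * Z_ex))"
  hence ij: "i < 3" "j < 3" by (auto simp: carrier_matD[OF U_ex_carrier] carrier_matD[OF Z_ex_carrier])
  have "(if i = 2 then -1 else 1) * U_ex n m $$ (i, j) =
    (-1) ^ (parity n + parity m) * ((if j = 2 then -1 else 1) * U_ex n m $$ (i, j))"
  proof (cases "m = 0")
    case True
    then show ?thesis using assms ij
      by (cases "n = 0") (auto simp: U_ex_index parity_def bin_digit1_def bin_digit2_def)
  next
    case False
    have "i \<in> {0, 1, 2}" "j \<in> {0, 1, 2}" using ij by auto
    with False show ?thesis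
      using assms ij by (auto simp: U_ex_index parity_def bin_digit1_def bin_digit2_def)
  qed
  then show "(Z_ex * U_ex n m) $$ (i, j) = ((-1) ^ (parity n + parity m) \<cdot>\<^sub>m (U_ex n m * Z_ex)) $$ (i, j)"
    using ij carrier_matD[OF U_ex_carrier[of n m]] carrier_matD[OF Z_ex_carrier]
    by (simp add: Z_ex_mult_index[OF U_ex_carrier ij] del: index_mult_mat(1))
qed (auto simp: carrier_matD[OF U_ex_carrier] carrier_matD[OF Z_ex_carrier])

theorem mainTheorem1:
  shows "(\<exists>D Z U. is_fMPU D Z U \<and> \<not> locality_preserving (fMPO D Z U))
    \<and> (\<forall>n<4. \<forall>m<4. Z_ex * U_ex n m = (-1) ^ (parity n + parity m) \<cdot>\<^sub>m (U_ex n m * Z_ex))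
    \<and> (\<forall>N\<ge>1. unitary_mat (2 ^ (2 * N)) (fMPO 3 Z_ex U_ex N))
    \<and> \<not> locality_preserving (fMPO 3 Z_ex U_ex)"
proof -
  have "diagonal_mat Z_ex" by (auto simp: diagonal_mat_def carrier_matD[OF Z_ex_carrier] Z_ex_index)
  hence "is_fMPU 3 Z_ex U_ex"
    by (auto simp: is_fMPU_def graded_tensor_def graded_U_ex unitary_fMPO_ex Z_ex_index)
  then show ?thesis
    using graded_U_ex unitary_fMPO_ex not_locality_preserving_fMPO_ex by blast
qed

end
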